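(* The invariants $T_{\mathrm{HG}}$ and $\mathcal{T}_P$ are incomparable in distinguishing power, even among $4$-uniform hypergraphs with identical global parameters. That is, there exist $4$-uniform hypergraphs $H_1,H_2$ with the same number of vertices, components, edges and total degree such that $T_{\mathrm{HG}}(H_1)=T_{\mathrm{HG}}(H_2)$ but $\mathcal{T}_P(H_1)\ne\mathcal{T}_P(H_2)$, and there exist $4$-uniform hypergraphs $H_3,H_4$ with the same number of vertices, components, edges and total degree such that $\mathcal{T}_P(H_3)=\mathcal{T}_P(H_4)$ but $T_{\mathrm{HG}}(H_3)\ne T_{\mathrm{HG}}(H_4)$. Here $\mathcal{T}_P(H)$ denotes the polymatroid Tutte polynomial $\mathcal{T}$ of the associated polymatroid $P_H$ of $H$.
   Context: A hypergraph is a pair $H=(V,E)$ where $V$ is a finite set and $E$ is a finite multiset (parallel hyperedges are allowed and treated as distinct elements of $E$) of multisets of elements of $V$, called hyperedges. For $e\in E$, $d(e)$ is the size of $e$ counted with multiplicity; it is always assumed that $d(e)>1$. $H$ is $4$-uniform if $d(e)=4$ for all $e$. Write $v(H)=|V|$. $\kappa(H)$ is the number of connected components of the bipartite incidence graph with vertex classes $V$ and $E$, in which $u\in V$ and $e\in E$ are joined by as many edges as the multiplicity of $u$ in $e$. For $A\subseteq E$ let $\kappa(A)=\kappa((V,A))$, $d(A)=\sum_{e\in A}d(e)$ (the total degree of $H$ is $d(E)$), and $|A|$ is the number of hyperedges in $A$. Hypergraph Tutte polynomial: $T_{\mathrm{HG}}(H)=T_{\mathrm{HG}}(H;x,y)=\sum_{A\subseteq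 E}(x-1)^{\kappa(A)-\kappa(H)}(y-1)^{d(A)-|A|-v(H)+\kappa(A)}$. A polymatroid is a pair $P=(E,r)$ with $E$ finite and $r:2^E\to\mathbb{Z}$ normalized ($r(\emptyset)=0$), increasing and submodular. The associated polymatroid $P_H$ has groundset $E$ and rank function $r(A)=v(H)-\kappa(A)$. The polymatroid Tutte polynomial $\mathcal{T}_P(x,y)$ (Bernardi–Kálmán–Postnikov) is given recursively: $\mathcal{T}_P=1$ if $E=\emptyset$. Otherwise fix any $e\in E$, set $\alpha_e=r(E)-r(E\setminus\{e\})$, $\beta_e=r(\{e\})$, and for each integer $\alpha_e\le j\le\beta_e$ let $P_{e,j}$ be the polymatroid on $E\setminus\{e\}$ with rank function $r_{e,j}(A)=\min\{r(A),\,r(A\cup\{e\})-j\}$ (so $P_{e,\alpha_e}=P\setminus e$ is the deletion and $P_{e,\beta_e}=P/e$ the contraction). Then $\mathcal{T}_P=(x+y-1)\mathcal{T}_{P\setminus e}$ if $\alpha_e=\beta_e$, and $\mathcal{T}_P=x\,\mathcal{T}_{P\setminus e}+y\,\mathcal{T}_{P/e}+\sum_{j=\alpha_e+1}^{\beta_e-1}\mathcal{T}_{P_{e,j}}$ if $\alpha_e<\beta_e$. It is known that the result is independent of the choices of $e$. An invariant $F_1$ is less distinguishing than $F_2$ if $F_2(H)=F_2(H')$ implies $F_1(H)=F_1(H')$ for all $H,H'$; $F_1,F_2$ are incomparable in distinguishing power if neither is less distinguishing than the other. *)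

theory Defs
  imports "HOL-Library.Multiset" "HOL-Computational_Algebra.Polynomial"
begin

text \<open>The multiset of hyperedges is represented as a family of multisets indexed by the finite
  set \<open>edges H\<close>, so that parallel hyperedges are distinct elements of \<open>edges H\<close>.\<close>

record ('v, 'e) hgraph =
  verts :: "'v set"
  edges :: "'e set"
  ends :: "'e \<Rightarrow> 'v multiset"

definition hypergraph :: "('v, 'e) hgraph \<Rightarrow> bool" where
  "hypergraph H \<longleftrightarrow> finite (verts H) \<and> finite (edges H) \<and>
     (\<forall>e\<in>edges H. set_mset (ends H e) \<subseteq> verts H \<and> size (ends H e) > 1)"

definition uniform_hypergraph :: "nat \<Rightarrow> ('v, 'e) hgraph \<Rightarrow> bool" where
  "uniform_hypergraph k H \<longleftrightarrow> hypergraph H \<and> (\<forall>e\<in>edges H. size (ends H e) = k)"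

definition total_degree :: "('v, 'e) hgraph \<Rightarrow> 'e set \<Rightarrow> nat" where
  "total_degree H A = (\<Sum>e\<in>A. size (ends H e))"

text \<open>Adjacency in the bipartite incidence graph of \<open>(V, A)\<close>. Its edge multiplicities are the
  multiplicities \<open>count (ends H e) u\<close>; for connectivity only their positivity matters.\<close>

definition incidence :: "('v, 'e) hgraph \<Rightarrow> 'e set \<Rightarrow> (('v + 'e) \<times> ('v + 'e)) set" where
  "incidence H A = {(Inl u, Inr e) | u e. u \<in> verts H \<and> e \<in> A \<and> count (ends H e) u > 0}"

definition connected_rel :: "('v, 'e) hgraph \<Rightarrow> 'e set \<Rightarrow> (('v + 'e) \<times> ('v + 'e)) set" where
  "connected_rel H A =
     {(p, q). p \<in> verts H <+> A \<and> q \<in> verts H <+> A \<and>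
        (p, q) \<in> (incidence H A \<union> (incidence H A)\<inverse>)\<^sup>*}"

definition kappa :: "('v, 'e) hgraph \<Rightarrow> 'e set \<Rightarrow> nat" where
  "kappa H A = card ((verts H <+> A) // connected_rel H A)"

text \<open>Elements of \<open>\<int>[x, y]\<close> are represented in \<open>\<int>[x][y]\<close>.\<close>

definition varX :: "int poly poly" where
  "varX = [:[:0, 1:]:]"

definition varY :: "int poly poly" where
  "varY = [:0, 1:]"

text \<open>Neither subtraction of exponents truncates on a hypergraph: adding a (nonempty) hyperedge
  \<open>e\<close> to \<open>A\<close> never increases the number of components, and decreases it by at most
  \<open>size (ends H e) - 1\<close>, starting from \<open>kappa H {} = card (verts H)\<close>.\<close>

definition tutte_HG :: "('v, 'e) hgraph \<Rightarrow> int poly poly" where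
  "tutte_HG H = (\<Sum>A\<in>Pow (edges H).
      (varX - 1) ^ (kappa H A - kappa H (edges H)) *
      (varY - 1) ^ (total_degree H A + kappa H A - (card A + card (verts H))))"

definition minor_rank :: "('e set \<Rightarrow> int) \<Rightarrow> 'e \<Rightarrow> int \<Rightarrow> 'e set \<Rightarrow> int" where
  "minor_rank r e j A = min (r A) (r (insert e A) - j)"

text \<open>The polymatroid Tutte polynomial of \<open>(E, r)\<close>. For polymatroids the result does not depend
  on the element expanded at, which is therefore left to the choice operator; deletion and
  contraction of \<open>e\<close> are the minors at \<open>j = \<alpha>\<close> and \<open>j = \<beta>\<close>. On infinite \<open>E\<close> the value is
  junk.\<close>

function tutte_polymatroid :: "'e set \<Rightarrow> ('e set \<Rightarrow> int) \<Rightarrow> int poly poly" where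
  "tutte_polymatroid E r =
     (if E = {} \<or> infinite E then 1
      else let e = (SOME e. e \<in> E);
               \<alpha> = r E - r (E - {e});
               \<beta> = r {e}
           in if \<alpha> = \<beta> then (varX + varY - 1) * tutte_polymatroid (E - {e}) (minor_rank r e \<alpha>)
              else varX * tutte_polymatroid (E - {e}) (minor_rank r e \<alpha>)
                 + varY * tutte_polymatroid (E - {e}) (minor_rank r e \<beta>)
                 + (\<Sum>j\<in>{\<alpha><..<\<beta>}. tutte_polymatroid (E - {e}) (minor_rank r e j)))"
  by pat_completeness auto
termination
  by (relation "measure (\<lambda>(E, r). card E)")
     (auto intro!: card_Diff1_less intro: some_in_eq[THEN iffD2])

declare tutte_polymatroid.simps [simp del]

definition polymatroid_rank :: "('v, 'e) hgraph \<Rightarrow> 'e set \<Rightarrow> int" where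
  "polymatroid_rank H A = int (card (verts H)) - int (kappa H A)"

definition tutte_P :: "('v, 'e) hgraph \<Rightarrow> int poly poly" where
  "tutte_P H = tutte_polymatroid (edges H) (polymatroid_rank H)"

definition less_distinguishing :: "'h set \<Rightarrow> ('h \<Rightarrow> 'a) \<Rightarrow> ('h \<Rightarrow> 'b) \<Rightarrow> bool" where
  "less_distinguishing \<H> F1 F2 \<longleftrightarrow> (\<forall>H\<in>\<H>. \<forall>H'\<in>\<H>. F2 H = F2 H' \<longrightarrow> F1 H = F1 H')"

definition incomparable :: "'h set \<Rightarrow> ('h \<Rightarrow> 'a) \<Rightarrow> ('h \<Rightarrow> 'b) \<Rightarrow> bool" where
  "incomparable \<H> F1 F2 \<longleftrightarrow> \<not> less_distinguishing \<H> F1 F2 \<and> \<not> less_distinguishing \<H> F2 F1"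

definition same_parameters :: "('v, 'e) hgraph \<Rightarrow> ('v, 'e) hgraph \<Rightarrow> bool" where
  "same_parameters H H' \<longleftrightarrow>
     card (verts H) = card (verts H') \<and>
     kappa H (edges H) = kappa H' (edges H') \<and>
     card (edges H) = card (edges H') \<and>
     total_degree H (edges H) = total_degree H' (edges H')"

end

theory Submission
  imports Defs
begin

text \<open>Both pairs of witnesses consist of hypergraphs whose hyperedges share a common vertex; then
  the rank of \<open>A\<close> is one less than the number of vertices covered by \<open>A\<close> and that vertex.

  For a \<open>k\<close>-uniform hypergraph, \<open>tutte_HG\<close> records how many sets of hyperedges have given size and
  rank, but not how these sets are nested. Two hypergraphs with three hyperedges, where the same
  ranks are distributed differently over the pairs, are told apart by the value of \<open>tutte_P\<close> at
  \<open>(1, 1)\<close>, the number of lattice points of the base polytope.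

  Conversely \<open>tutte_P\<close> is \<open>(x + y - 1)\<^sup>2\<close> for every modular rank function on two elements, so it
  cannot distinguish hyperedges of ranks \<open>1, 1\<close> from hyperedges of ranks \<open>0, 2\<close>.\<close>

section \<open>Counting components when all hyperedges share a vertex\<close>

lemma card_quotient_kernel:
  "card (C // {(p, q). p \<in> C \<and> q \<in> C \<and> f p = f q}) = card (f ` C)"
proof -
  let ?R = "{(p, q). p \<in> C \<and> q \<in> C \<and> f p = f q}"
  let ?g = "\<lambda>l. {q \<in> C. f q = l}"
  have img: "?R `` {p} = ?g (f p)" if "p \<in> C" for p
    using that by auto
  have "C // ?R = ?g ` f ` C"
    unfolding quotient_def image_image using img by auto
  moreover have "inj_on ?g (f ` C)"
    by (auto simp: inj_on_def)
  ultimately show ?thesis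
    by (simp add: card_image)
qed

text \<open>The hyperedges in \<open>A\<close> and the vertices they cover lie in the component of
  \<open>z\<close>; every other vertex is isolated. Inserting \<open>z\<close> also covers the case
  of empty \<open>A\<close>.\<close>

lemma kappa_common_vertex:
  assumes z: "z \<in> verts H"
    and A: "\<And>e. e \<in> A \<Longrightarrow> z \<in># ends H e \<and> set_mset (ends H e) \<subseteq> verts H"
  shows "kappa H A = card (insert z (verts H - (\<Union>e\<in>A. set_mset (ends H e))))"
proof -
  define U where "U = insert z (\<Union>e\<in>A. set_mset (ends H e))"
  \<comment> \<open>\<open>f\<close> labels each node with a vertex representing its component. It
    is constant along incidences, hence along paths; conversely every node is connected to its
    label.\<close>
  define f where "f = case_sum (\<lambda>v. if v \<in> U then z else v) (\<lambda>_::'b. z)"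
  let ?C = "verts H <+> A"
  let ?S = "incidence H A \<union> (incidence H A)\<inverse>"
  have "f p = f q" if "(p, q) \<in> ?S\<^sup>*" for p q
    using that
  proof induction
    case (step q r)
    then show ?case
      by (auto simp: incidence_def f_def U_def split: if_splits)
  qed simp
  moreover have sym: "(q, p) \<in> ?S\<^sup>*" if "(p, q) \<in> ?S\<^sup>*" for p q
    using that sym_rtrancl[of ?S] by (auto simp: sym_Un_converse dest: symD)
  have edge: "(Inr e, Inl z) \<in> ?S\<^sup>*" if "e \<in> A" for e
    using that z A by (intro r_into_rtrancl) (auto simp: incidence_def)
  have to_z: "(p, Inl (f p)) \<in> ?S\<^sup>*" if p: "p \<in> ?C" for p
  proof (cases p)
    case (Inr e)
    then show ?thesis using p edge by (auto simp: f_def)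
  next
    case (Inl v)
    show ?thesis
    proof (cases "v \<in> U \<and> v \<noteq> z")
      case True
      then obtain e where e: "e \<in> A" "v \<in># ends H e"
        by (auto simp: U_def)
      then have "(Inl v, Inr e) \<in> ?S"
        using A by (auto simp: incidence_def)
      then show ?thesis
        using edge[OF e(1)] True Inl by (auto simp: f_def intro: converse_rtrancl_into_rtrancl)
    qed (auto simp: Inl f_def)
  qed
  have "(p, q) \<in> ?S\<^sup>*" if "p \<in> ?C" "q \<in> ?C" "f p = f q" for p q
    using to_z[OF that(1)] sym[OF to_z[OF that(2)]] that(3) by (auto intro: rtrancl_trans)
  ultimately have "connected_rel H A = {(p, q). p \<in> ?C \<and> q \<in> ?C \<and> f p = f q}"
    unfolding connected_rel_def by blast
  then have "kappa H A = card (f ` ?C)"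
    unfolding kappa_def by (simp only: card_quotient_kernel)
  also have "f ` ?C = insert z (verts H - (\<Union>e\<in>A. set_mset (ends H e)))"
    using z by (auto simp: f_def U_def Plus_def image_Un image_image split: if_splits)
  finally show ?thesis .
qed

text \<open>Splitting subsets by membership of \<open>a\<close> lets the sum in
  \<open>tutte_HG\<close> be expanded over explicit hyperedges.\<close>

lemma sum_Pow_insert:
  assumes "finite B" "a \<notin> B"
  shows "(\<Sum>A\<in>Pow (insert a B). f A) = (\<Sum>A\<in>Pow B. f A) + (\<Sum>A\<in>Pow B. f (insert a A))"
proof -
  have "inj_on (insert a) (Pow B)"
    using assms by (auto simp: inj_on_def)
  moreover have "Pow B \<inter> insert a ` Pow B = {}"
    using assms by auto
  ultimately show ?thesis
    using assms by (simp add: Pow_insert sum.union_disjoint sum.reindex)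
qed

section \<open>Polymatroid Tutte polynomials on at most two elements\<close>

lemma tutte_polymatroid_empty [simp]: "tutte_polymatroid {} r = 1"
  by (simp add: tutte_polymatroid.simps)

text \<open>The element picked by the choice operator is unknown, hence values of
  \<open>tutte_polymatroid\<close> are established by computing the expansion at every element.\<close>

lemma tutte_polymatroid_eqI:
  assumes "finite E" "E \<noteq> {}"
    and "\<And>e. e \<in> E \<Longrightarrow>
      (let \<alpha> = r E - r (E - {e}); \<beta> = r {e}; T = \<lambda>j. tutte_polymatroid (E - {e}) (minor_rank r e j)
       in if \<alpha> = \<beta> then (varX + varY - 1) * T \<alpha>
          else varX * T \<alpha> + varY * T \<beta> + (\<Sum>j\<in>{\<alpha><..<\<beta>}. T j)) = p"
  shows "tutte_polymatroid E r = p"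
proof -
  have "(SOME e. e \<in> E) \<in> E"
    using assms(2) by (simp add: some_in_eq)
  from assms(3)[OF this] show ?thesis
    using assms(1,2) by (simp add: tutte_polymatroid.simps[of E r] Let_def)
qed

lemma tutte_polymatroid_singleton:
  assumes "r {} = 0"
  shows "tutte_polymatroid {a} r = varX + varY - 1"
  by (rule tutte_polymatroid_eqI) (use assms in auto)

text \<open>Modularity forces \<alpha> = \<beta> at either element, and the remaining singleton
  minor is again normalized, so each element contributes one factor.\<close>

lemma tutte_polymatroid_modular_pair:
  assumes "a \<noteq> b" "r {} = 0" "r {a, b} = r {a} + r {b}"
  shows "tutte_polymatroid {a, b} r = (varX + varY - 1)\<^sup>2"
proof (rule tutte_polymatroid_eqI, goal_cases)
  case (3 e)
  then consider "e = a" "{a, b} - {e} = {b}" | "e = b" "{a, b} - {e} = {a}"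
    using assms(1) by auto
  then show ?case
    by cases (use assms in \<open>simp_all add: tutte_polymatroid_singleton minor_rank_def
      power2_eq_square\<close>)
qed auto

section \<open>The value of the polymatroid Tutte polynomial at (1, 1)\<close>

definition base_count :: "'e set \<Rightarrow> ('e set \<Rightarrow> int) \<Rightarrow> int" where
  "base_count E r = poly (poly (tutte_polymatroid E r) 1) 1"

lemma base_count_singleton:
  "r {} = 0 \<Longrightarrow> base_count {a} r = 1"
  by (simp add: base_count_def tutte_polymatroid_singleton varX_def varY_def)

text \<open>At x = y = 1 the coefficients x, y and x + y - 1 all become 1, so both branches of the
  recursion merge into one sum over all j from \<alpha> to \<beta>. The sum is required at every
  element because the chosen one is unknown.\<close>

lemma base_count_eqI:
  assumes "finite E" "E \<noteq> {}"
    and le: "\<And>e. e \<in> E \<Longrightarrow> r E - r (E - {e}) \<le> r {e}"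
    and N: "\<And>e. e \<in> E \<Longrightarrow>
      (\<Sum>j = r E - r (E - {e})..r {e}. base_count (E - {e}) (minor_rank r e j)) = n"
  shows "base_count E r = n"
proof -
  define e where "e = (SOME e. e \<in> E)"
  have e: "e \<in> E"
    using assms(2) by (simp add: some_in_eq e_def)
  let ?\<alpha> = "r E - r (E - {e})" and ?\<beta> = "r {e}"
  let ?T = "\<lambda>j. tutte_polymatroid (E - {e}) (minor_rank r e j)"
  have T: "tutte_polymatroid E r =
      (if ?\<alpha> = ?\<beta> then (varX + varY - 1) * ?T ?\<alpha>
       else varX * ?T ?\<alpha> + varY * ?T ?\<beta> + (\<Sum>j\<in>{?\<alpha><..<?\<beta>}. ?T j))"
    using assms(1,2) by (simp add: tutte_polymatroid.simps[of E r] Let_def e_def)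
  have "base_count E r = (\<Sum>j = ?\<alpha>..?\<beta>. base_count (E - {e}) (minor_rank r e j))"
  proof (cases "?\<alpha> = ?\<beta>")
    case True
    then show ?thesis
      using T by (simp add: base_count_def varX_def varY_def)
  next
    case False
    \<comment> \<open>By \<open>le\<close> both end points lie in the interval, and here they are
      distinct, so each is counted exactly once.\<close>
    with le[OF e] have "{?\<alpha>..?\<beta>} = insert ?\<alpha> (insert ?\<beta> {?\<alpha><..<?\<beta>})"
      by auto
    then show ?thesis
      using T False by (simp add: base_count_def varX_def varY_def poly_sum)
  qed
  with N[OF e] show ?thesis by simp
qed

text \<open>Each minor on the remaining element counts 1, so the value is the number of integers
  from \<alpha> to \<beta>.\<close>

lemma base_count_pair:
  assumes "a \<noteq> b" "r {} = 0" "r {a, b} \<le> r {a} + r {b}"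
  shows "base_count {a, b} r = r {a} + r {b} - r {a, b} + 1"
proof (rule base_count_eqI, goal_cases)
  case (3 e)
  then consider "e = a" "{a, b} - {e} = {b}" | "e = b" "{a, b} - {e} = {a}"
    using assms(1) by auto
  then show ?case
    by cases (use assms in simp_all)
next
  case (4 e)
  then consider "e = a" "{a, b} - {e} = {b}" | "e = b" "{a, b} - {e} = {a}"
    using assms(1) by auto
  then show ?case
    by cases (use assms in \<open>simp_all add: base_count_singleton minor_rank_def\<close>)
qed auto

section \<open>The witnesses and their component numbers\<close>

definition hgraph_of_list :: "nat \<Rightarrow> nat multiset list \<Rightarrow> (nat, nat) hgraph" where
  "hgraph_of_list n es = \<lparr>verts = {..<n}, edges = {..<length es}, ends = (!) es\<rparr>"

lemma hgraph_of_list_simps [simp]: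
  "verts (hgraph_of_list n es) = {..<n}"
  "edges (hgraph_of_list n es) = {..<length es}"
  "ends (hgraph_of_list n es) = (!) es"
  by (simp_all add: hgraph_of_list_def)

lemma kappa_hgraph_of_list:
  assumes "z < n" "A \<subseteq> {..<length es}"
    and "\<forall>e\<in>set es. z \<in># e \<and> set_mset e \<subseteq> {..<n}"
  shows "kappa (hgraph_of_list n es) A = card (insert z ({..<n} - (\<Union>e\<in>A. set_mset (es ! e))))"
  using assms by (subst kappa_common_vertex[of z]) (auto simp: subset_eq)

text \<open>Repeating vertex 0 pads hyperedges to size 4 without affecting ranks. Single hyperedges
  have ranks 2, 2, 1. The only pair of rank 2 consists of the two parallel hyperedges, which stay
  distinct as list positions; the other pairs have rank 3.\<close>

definition H1 :: "(nat, nat) hgraph" where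
  "H1 = hgraph_of_list 4 [{#0, 0, 1, 2#}, {#0, 0, 1, 2#}, {#0, 0, 0, 3#}]"

text \<open>The ranks in each size are those of \<open>H1\<close>, but the pair of rank 2 now
  consists of hyperedges of ranks 2 and 1.\<close>

definition H2 :: "(nat, nat) hgraph" where
  "H2 = hgraph_of_list 4 [{#0, 0, 2, 3#}, {#0, 0, 1, 2#}, {#0, 0, 0, 1#}]"

definition H3 :: "(nat, nat) hgraph" where
  "H3 = hgraph_of_list 3 [{#0, 0, 0, 1#}, {#0, 0, 0, 2#}]"

text \<open>The hyperedge supported on vertex 0 alone has rank 0, the other one has full rank
  2.\<close>

definition H4 :: "(nat, nat) hgraph" where
  "H4 = hgraph_of_list 3 [{#0, 0, 0, 0#}, {#0, 0, 1, 2#}]"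

lemma lessThan_3: "{..<3::nat} = {0, 1, 2}"
  and lessThan_4: "{..<4::nat} = {0, 1, 2, 3}"
  by auto

lemma hgraph_sels [simp]:
  "verts H1 = {0, 1, 2, 3}" "edges H1 = {0, 1, 2}"
  "verts H2 = {0, 1, 2, 3}" "edges H2 = {0, 1, 2}"
  "verts H3 = {0, 1, 2}" "edges H3 = {0, 1}"
  "verts H4 = {0, 1, 2}" "edges H4 = {0, 1}"
  by (auto simp: H1_def H2_def H3_def H4_def)

lemma uniform: "uniform_hypergraph 4 H1" "uniform_hypergraph 4 H2"
  "uniform_hypergraph 4 H3" "uniform_hypergraph 4 H4"
  by (auto simp: uniform_hypergraph_def hypergraph_def H1_def H2_def H3_def H4_def
      numeral_2_eq_2 numeral_3_eq_3 less_Suc_eq)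

lemma kappa_H1:
  "kappa H1 {} = 4" "kappa H1 {0} = 2" "kappa H1 {1} = 2" "kappa H1 {2} = 3"
  "kappa H1 {0, 1} = 2" "kappa H1 {0, 2} = 1" "kappa H1 {1, 2} = 1" "kappa H1 {0, 1, 2} = 1"
  unfolding H1_def
  by (subst kappa_hgraph_of_list[of 0]; auto simp: lessThan_4 insert_Diff_if)+

lemma kappa_H2:
  "kappa H2 {} = 4" "kappa H2 {0} = 2" "kappa H2 {1} = 2" "kappa H2 {2} = 3"
  "kappa H2 {0, 1} = 1" "kappa H2 {0, 2} = 1" "kappa H2 {1, 2} = 2" "kappa H2 {0, 1, 2} = 1"
  unfolding H2_def
  by (subst kappa_hgraph_of_list[of 0]; auto simp: lessThan_4 insert_Diff_if)+

lemma kappa_H3: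
  "kappa H3 {} = 3" "kappa H3 {0} = 2" "kappa H3 {1} = 2" "kappa H3 {0, 1} = 1"
  unfolding H3_def
  by (subst kappa_hgraph_of_list[of 0]; auto simp: lessThan_3 insert_Diff_if)+

lemma kappa_H4:
  "kappa H4 {} = 3" "kappa H4 {0} = 3" "kappa H4 {1} = 1" "kappa H4 {0, 1} = 1"
  unfolding H4_def
  by (subst kappa_hgraph_of_list[of 0]; auto simp: lessThan_3 insert_Diff_if)+

lemma total_degree_uniform:
  assumes "uniform_hypergraph k H" "A \<subseteq> edges H"
  shows "total_degree H A = k * card A"
  using assms by (auto simp: total_degree_def uniform_hypergraph_def subset_eq)

section \<open>Comparing the hypergraph Tutte polynomials\<close>

lemma tutte_HG_uniform:
  assumes "uniform_hypergraph k H"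
  shows "tutte_HG H = (\<Sum>A\<in>Pow (edges H). (varX - 1) ^ (kappa H A - kappa H (edges H)) *
      (varY - 1) ^ (k * card A + kappa H A - (card A + card (verts H))))"
  unfolding tutte_HG_def by (rule sum.cong) (simp_all add: total_degree_uniform[OF assms])

text \<open>In both hypergraphs the component numbers are 2, 2, 3 on single hyperedges and 1, 1, 2
  on pairs, up to order, so the summands agree after a permutation.\<close>

lemma tutte_HG_H1_H2: "tutte_HG H1 = tutte_HG H2"
  by (simp add: uniform[THEN tutte_HG_uniform] sum_Pow_insert
      kappa_H1[simplified] kappa_H2[simplified])

lemma tutte_HG_H3_H4: "tutte_HG H3 \<noteq> tutte_HG H4"
proof -
  \<comment> \<open>The outer variable is y, so this evaluates at x = 1, y = 3. Only sets with as
    many components as the whole hypergraph survive: the full set contributes 2^4 to each side, and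
    for \<open>H4\<close> the set \<open>{1}\<close> adds 2, giving 16 against 18.\<close>
  have "poly (poly (tutte_HG H3) [:3:]) 1 \<noteq> poly (poly (tutte_HG H4) [:3:]) 1"
    by (simp add: uniform[THEN tutte_HG_uniform] sum_Pow_insert varX_def varY_def
      kappa_H3[simplified] kappa_H4[simplified])
  then show ?thesis by auto
qed

section \<open>Comparing the polymatroid Tutte polynomials\<close>

lemma tutte_P_H3_H4: "tutte_P H3 = tutte_P H4"
  by (simp add: tutte_P_def tutte_polymatroid_modular_pair polymatroid_rank_def
      kappa_H3[simplified] kappa_H4[simplified])

lemma delete_triple:
  "{0, Suc 0, 2} - {0} = {Suc 0, 2}" "{0, Suc 0, 2} - {Suc 0} = {0, 2}"
  "{0, Suc 0, 2} - {2} = {0, Suc 0}"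
  by auto

text \<open>The insertions in \<open>minor_rank\<close> permute set displays; these rules restore
  the order used in the component numbers. \<open>Suc 0\<close> is the form that simplification
  gives to 1.\<close>

lemma insert_triple:
  "{Suc 0, 0} = {0, Suc 0}" "{2, 0} = {0, 2::nat}" "{2, Suc 0} = {Suc 0, 2}"
  "{Suc 0, 0, 2} = {0, Suc 0, 2}" "{2, 0, Suc 0} = {0, Suc 0, 2}"
  by auto

lemma int_intervals: "{0..1::int} = {0, 1}" "{0..2::int} = {0, 1, 2}" "{1..2::int} = {1, 2}"
  by auto

text \<open>The three lattice points are (2, 0, 1), (1, 1, 1) and (0, 2, 1): the last coordinate is
  forced to be 1.\<close>

lemma base_count_H1: "base_count {0, 1, 2} (polymatroid_rank H1) = 3"
proof (rule base_count_eqI, goal_cases)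
  case (3 e)
  then consider "e = 0" | "e = 1" | "e = 2" by auto
  then show ?case
    by cases (simp_all add: polymatroid_rank_def delete_triple kappa_H1[simplified])
next
  case (4 e)
  then consider "e = 0" | "e = 1" | "e = 2" by auto
  then show ?case
    by cases (simp_all add: polymatroid_rank_def delete_triple kappa_H1[simplified]
      base_count_pair minor_rank_def insert_triple int_intervals)
qed auto

text \<open>The four lattice points are (1, 2, 0), (1, 1, 1), (2, 1, 0) and (2, 0, 1).\<close>

lemma base_count_H2: "base_count {0, 1, 2} (polymatroid_rank H2) = 4"
proof (rule base_count_eqI, goal_cases)
  case (3 e)
  then consider "e = 0" | "e = 1" | "e = 2" by auto
  then show ?case
    by cases (simp_all add: polymatroid_rank_def delete_triple kappa_H2[simplified])
next
  case (4 e)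
  then consider "e = 0" | "e = 1" | "e = 2" by auto
  then show ?case
    by cases (simp_all add: polymatroid_rank_def delete_triple kappa_H2[simplified]
      base_count_pair minor_rank_def insert_triple int_intervals)
qed auto

lemma tutte_P_H1_H2: "tutte_P H1 \<noteq> tutte_P H2"
proof
  assume "tutte_P H1 = tutte_P H2"
  then have "base_count {0, 1, 2} (polymatroid_rank H1) = base_count {0, 1, 2} (polymatroid_rank H2)"
    by (simp add: tutte_P_def base_count_def)
  then show False
    by (simp only: base_count_H1 base_count_H2)
qed

theorem proposition6p3:
  shows "incomparable {H :: (nat, nat) hgraph. hypergraph H} tutte_HG tutte_P \<and>
    (\<exists>H1 H2 :: (nat, nat) hgraph.
        uniform_hypergraph 4 H1 \<and> uniform_hypergraph 4 H2 \<and> same_parameters H1 H2 \<and>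
        tutte_HG H1 = tutte_HG H2 \<and> tutte_P H1 \<noteq> tutte_P H2) \<and>
    (\<exists>H3 H4 :: (nat, nat) hgraph.
        uniform_hypergraph 4 H3 \<and> uniform_hypergraph 4 H4 \<and> same_parameters H3 H4 \<and>
        tutte_P H3 = tutte_P H4 \<and> tutte_HG H3 \<noteq> tutte_HG H4)"
proof (intro conjI)
  have "hypergraph H1" "hypergraph H2" "hypergraph H3" "hypergraph H4"
    using uniform by (simp_all add: uniform_hypergraph_def)
  \<comment> \<open>The pair \<open>H1\<close>, \<open>H2\<close> refutes that
    \<open>tutte_P\<close> is less distinguishing than \<open>tutte_HG\<close>; the pair
    \<open>H3\<close>, \<open>H4\<close> refutes the converse.\<close>
  then show "incomparable {H :: (nat, nat) hgraph. hypergraph H} tutte_HG tutte_P"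
    unfolding incomparable_def less_distinguishing_def
    using tutte_HG_H1_H2 tutte_P_H1_H2 tutte_P_H3_H4 tutte_HG_H3_H4 by blast
  have "same_parameters H1 H2" "same_parameters H3 H4"
    by (simp_all add: same_parameters_def uniform[THEN total_degree_uniform]
        kappa_H1[simplified] kappa_H2[simplified] kappa_H3[simplified] kappa_H4[simplified])
  then show "\<exists>H1 H2 :: (nat, nat) hgraph.
        uniform_hypergraph 4 H1 \<and> uniform_hypergraph 4 H2 \<and> same_parameters H1 H2 \<and>
        tutte_HG H1 = tutte_HG H2 \<and> tutte_P H1 \<noteq> tutte_P H2"
    and "\<exists>H3 H4 :: (nat, nat) hgraph.
        uniform_hypergraph 4 H3 \<and> uniform_hypergraph 4 H4 \<and> same_parameters H3 H4 \<and>
        tutte_P H3 = tutte_P H4 \<and> tutte_HG H3 \<noteq> tutte_HG H4"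
    using uniform tutte_HG_H1_H2 tutte_P_H1_H2 tutte_P_H3_H4 tutte_HG_H3_H4 by blast+
qed

end
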